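(* Let $d\ge1$ and $n\ge d+1$. Let $u_1,\dots,u_n$ be unit vectors in $\mathbb{R}^d$ in general linear position, and for $R>1$ set $$\lambda_R:=\big(u_1\,|\,R\,u_2\,|\,R^2u_3\,|\,\dots\,|\,R^{n-1}u_n\big)\in\mathbb{R}^{d\times n}.$$ Then there is $R_0=R_0(u_1,\dots,u_n)$ such that for every $R\ge R_0$ the configuration $\lambda_R$ is regular and, for every $g=(\sigma,\varepsilon)\in\mathfrak B_n$, $$0\in H(g\lambda_R)\iff 0\in\operatorname{Conv}\big(\varepsilon_iu_{\sigma(i)}: i\in\mathrm{Rec}(\sigma)\big).$$
   Context: Vectors $q_1,\dots,q_N\in\mathbb{R}^d$ are in general linear position if $(q_i)_{i\in I}$ is linearly independent for every $I\subseteq\{1,\dots,N\}$ with $1\le|I|\le d$. For $X=(x_1|\dots|x_n)\in\mathbb{R}^{d\times n}$, put $s_k(X)=x_1+\dots+x_k$ for $1\le k\le n$ and $H(X)=\operatorname{Conv}(s_1(X),\dots,s_n(X))$. The group $\mathfrak B_n$ of signed permutations consists of pairs $g=(\sigma,\varepsilon)$, $\sigma$ a permutation of $\{1,\dots,n\}$ and $\varepsilon\in\{\pm1\}^n$, acting by $gX=(\varepsilon_1x_{\sigma(1)}|\dots|\varepsilon_nx_{\sigma(n)})$. $X$ is regular if for every $g\in\mathfrak B_n$ and every $d$-element set $I\subseteq\{1,\dots,n\}$ the vectors $s_i(gX)$, $i\in I$, are linearly independent. A position $i\in\{1,\dots,n\}$ is a record of the permutation $\sigma$ if $\sigma(j)<\sigma(i)$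 for all $j<i$; $\mathrm{Rec}(\sigma)$ is the set of record positions. *)

theory Defs
  imports "HOL-Analysis.Analysis"
begin

(* A configuration (x_1 | ... | x_n) is a function X :: nat => real ^ 'd, of which only the values
   at the indices 1, ..., n are ever used. The dimension is d = CARD('d), which is at least 1. *)

(* The first conjunct is needed because independent (v ` I) alone ignores repeated members. *)
definition lin_indep_family :: "nat set \<Rightarrow> (nat \<Rightarrow> real ^ 'd) \<Rightarrow> bool" where
  "lin_indep_family I v \<longleftrightarrow> inj_on v I \<and> independent (v ` I)"

definition general_linear_position :: "nat \<Rightarrow> (nat \<Rightarrow> real ^ 'd) \<Rightarrow> bool" where
  "general_linear_position N q \<longleftrightarrow>
     (\<forall>I \<subseteq> {1..N}. 1 \<le> card I \<and> card I \<le> CARD('d) \<longrightarrow> lin_indep_family I q)"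

definition partial_sum :: "(nat \<Rightarrow> real ^ 'd) \<Rightarrow> nat \<Rightarrow> real ^ 'd" where
  "partial_sum X k = (\<Sum>j = 1..k. X j)"

definition walk_hull :: "nat \<Rightarrow> (nat \<Rightarrow> real ^ 'd) \<Rightarrow> (real ^ 'd) set" where
  "walk_hull n X = convex hull (partial_sum X ` {1..n})"

(* Sign vectors are extensional, so this set has exactly 2^n * n! elements. *)
definition signed_perms :: "nat \<Rightarrow> ((nat \<Rightarrow> nat) \<times> (nat \<Rightarrow> real)) set" where
  "signed_perms n = {\<sigma>. \<sigma> permutes {1..n}} \<times> ({1..n} \<rightarrow>\<^sub>E {-1, 1})"

fun signed_act :: "(nat \<Rightarrow> nat) \<times> (nat \<Rightarrow> real) \<Rightarrow> (nat \<Rightarrow> real ^ 'd) \<Rightarrow> nat \<Rightarrow> real ^ 'd" where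
  "signed_act (\<sigma>, \<epsilon>) X i = \<epsilon> i *\<^sub>R X (\<sigma> i)"

definition regular_config :: "nat \<Rightarrow> (nat \<Rightarrow> real ^ 'd) \<Rightarrow> bool" where
  "regular_config n X \<longleftrightarrow>
     (\<forall>g \<in> signed_perms n. \<forall>I \<subseteq> {1..n}. card I = CARD('d) \<longrightarrow>
        lin_indep_family I (partial_sum (signed_act g X)))"

definition records :: "nat \<Rightarrow> (nat \<Rightarrow> nat) \<Rightarrow> nat set" where
  "records n \<sigma> = {i \<in> {1..n}. \<forall>j \<in> {1..<i}. \<sigma> j < \<sigma> i}"

definition lacunary_config :: "(nat \<Rightarrow> real ^ 'd) \<Rightarrow> real \<Rightarrow> nat \<Rightarrow> real ^ 'd" where
  "lacunary_config u R i = R ^ (i - 1) *\<^sub>R u i"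

lemma lin_indep_family_iff:
  fixes v :: "nat \<Rightarrow> real ^ 'd"
  assumes "finite I"
  shows "lin_indep_family I v \<longleftrightarrow>
    (\<forall>c. (\<Sum>i\<in>I. c i *\<^sub>R v i) = 0 \<longrightarrow> (\<forall>i\<in>I. c i = 0))"
proof
  assume L: "lin_indep_family I v"
  then have inj: "inj_on v I" and ind: "independent (v ` I)"
    by (auto simp: lin_indep_family_def)
  show "\<forall>c. (\<Sum>i\<in>I. c i *\<^sub>R v i) = 0 \<longrightarrow> (\<forall>i\<in>I. c i = 0)"
  proof (intro allI impI ballI)
    fix c i assume c: "(\<Sum>i\<in>I. c i *\<^sub>R v i) = 0" and i: "i \<in> I"
    have "(\<Sum>x\<in>v ` I. c (inv_into I v x) *\<^sub>R x) = 0"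
      using c by (simp add: sum.reindex[OF inj] inj)
    then have "c (inv_into I v (v i)) = 0"
      using independentD[OF ind, of "v ` I" "\<lambda>x. c (inv_into I v x)" "v i"] assms i by auto
    then show "c i = 0" using inj i by simp
  qed
next
  assume C: "\<forall>c. (\<Sum>i\<in>I. c i *\<^sub>R v i) = 0 \<longrightarrow> (\<forall>i\<in>I. c i = 0)"
  have inj: "inj_on v I"
  proof (rule inj_onI, rule ccontr)
    fix a b assume ab: "a \<in> I" "b \<in> I" "v a = v b" "a \<noteq> b"
    let ?c = "\<lambda>i. (if i = a then 1 else 0) - (if i = b then 1 else 0 :: real)"
    have "(\<Sum>i\<in>I. ?c i *\<^sub>R v i) =
        (\<Sum>i\<in>I. if i = a then v i else 0) - (\<Sum>i\<in>I. if i = b then v i else 0)"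
      unfolding sum_subtractf[symmetric] by (rule sum.cong) auto
    also have "\<dots> = 0" using ab assms by simp
    finally have "\<forall>i\<in>I. ?c i = 0" by (rule mp[OF spec[OF C]])
    from bspec[OF this ab(1)] show False using ab(4) by simp
  qed
  have "independent (v ` I)"
    unfolding independent_explicit_module
  proof (intro allI impI)
    fix T f x
    assume T: "finite T" "T \<subseteq> v ` I" "(\<Sum>y\<in>T. f y *\<^sub>R y) = 0" "x \<in> T"
    let ?c = "\<lambda>i. if v i \<in> T then f (v i) else 0"
    have "(\<Sum>i\<in>I. ?c i *\<^sub>R v i) = (\<Sum>y\<in>v ` I. (if y \<in> T then f y else 0) *\<^sub>R y)"
      by (simp add: sum.reindex[OF inj])
    also have "\<dots> = (\<Sum>y\<in>T. f y *\<^sub>R y)"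
      using T assms by (intro sum.mono_neutral_cong_right) auto
    also have "\<dots> = 0" by (rule T(3))
    finally have c0: "\<forall>i\<in>I. ?c i = 0" by (rule mp[OF spec[OF C]])
    obtain i where "i \<in> I" "x = v i" using T(2,4) by blast
    with bspec[OF c0, of i] T(4) show "f x = 0" by simp
  qed
  with inj show "lin_indep_family I v" by (simp add: lin_indep_family_def)
qed

end

theory Submission
  imports Defs
begin

text \<open>After division by its largest power of \<open>R\<close>, the partial sum of \<open>g\<lambda>\<^sub>R\<close> up to \<open>k\<close> tends to the
  signed vector \<open>\<plusminus>u\<^sub>i\<close> at the last record up to \<open>k\<close>. Linear independence of \<open>d\<close> vectors and \<open>0\<close> being
  interior to a convex hull are both expressed dually: no unit vector \<open>w\<close> has all its inner products
  with the given vectors in \<open>{0}\<close>, respectively in \<open>[0, \<infinity>)\<close>. By compactness of the sphere, such a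
  condition is stable under perturbation. General position excludes that \<open>0\<close> lies on the boundary of
  the limiting hull. For regularity, the partial sums are replaced by the sums over the disjoint blocks
  between consecutive elements of \<open>I\<close>, whose limits are multiples of distinct \<open>u\<^sub>i\<close>.\<close>

section \<open>Perturbation on the unit sphere and lacunary limits\<close>

text \<open>The total distance \<open>h w\<close> of the inner products from \<open>K\<close> is
  continuous and positive on the compact unit sphere, so it has a positive minimum there. Replacing
  \<open>v j\<close> by \<open>V j x\<close> moves the \<open>j\<close>-th inner product by at most
  \<open>norm (v j - V j x)\<close>, and the sum of these errors tends to 0.\<close>

lemma eventually_no_unit_vector_inner_in:
  fixes v :: "'b \<Rightarrow> 'a::euclidean_space" and V :: "'b \<Rightarrow> 'c \<Rightarrow> 'a" and K :: "real set"
  assumes J: "finite J" and K: "closed K" "K \<noteq> {}"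
    and lim: "\<And>j. j \<in> J \<Longrightarrow> (V j \<longlongrightarrow> v j) F"
    and v: "\<And>w. norm w = 1 \<Longrightarrow> \<exists>j\<in>J. w \<bullet> v j \<notin> K"
  shows "\<forall>\<^sub>F x in F. \<forall>w. norm w = 1 \<longrightarrow> (\<exists>j\<in>J. w \<bullet> V j x \<notin> K)"
proof -
  define h where "h w = (\<Sum>j\<in>J. infdist (w \<bullet> v j) K)" for w
  have "compact (sphere 0 1 :: 'a set)" "sphere (0::'a) 1 \<noteq> {}"
    by auto
  moreover have "continuous_on (sphere 0 1) h"
    unfolding h_def by (intro continuous_intros)
  ultimately obtain z where z: "norm z = 1" "\<And>w. norm w = 1 \<Longrightarrow> h z \<le> h w"
    by (metis continuous_attains_inf mem_sphere_0)
  have "h z > 0"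
  proof -
    from v[OF z(1)] obtain j where j: "j \<in> J" "z \<bullet> v j \<notin> K" by blast
    then have "infdist (z \<bullet> v j) K > 0"
      using K infdist_nonneg[of "z \<bullet> v j" K] in_closed_iff_infdist_zero[of K "z \<bullet> v j"] by linarith
    then show ?thesis
      unfolding h_def using J j(1) by (intro sum_pos2[of J j]) (auto simp: infdist_nonneg)
  qed
  have "((\<lambda>x. \<Sum>j\<in>J. norm (v j - V j x)) \<longlongrightarrow> (\<Sum>j\<in>J. norm (v j - v j))) F"
    by (intro tendsto_intros lim)
  then have "\<forall>\<^sub>F x in F. (\<Sum>j\<in>J. norm (v j - V j x)) < h z"
    using \<open>h z > 0\<close> by (intro order_tendstoD) auto
  then show ?thesis
  proof eventually_elim
    case (elim x)
    show ?case
    proof (intro allI impI, rule ccontr)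
      fix w :: 'a assume w: "norm w = 1" and "\<not> (\<exists>j\<in>J. w \<bullet> V j x \<notin> K)"
      then have inK: "w \<bullet> V j x \<in> K" if "j \<in> J" for j using that by blast
      have "infdist (w \<bullet> v j) K \<le> norm (v j - V j x)" if "j \<in> J" for j
      proof -
        have "infdist (w \<bullet> v j) K \<le> dist (w \<bullet> v j) (w \<bullet> V j x)"
          using inK[OF that] by (rule infdist_le)
        also have "\<dots> = \<bar>w \<bullet> (v j - V j x)\<bar>"
          by (simp add: dist_real_def inner_diff_right)
        also have "\<dots> \<le> norm (v j - V j x)"
          using Cauchy_Schwarz_ineq2[of w "v j - V j x"] w by simp
        finally show ?thesis .
      qed
      then have "h w \<le> (\<Sum>j\<in>J. norm (v j - V j x))"
        unfolding h_def by (rule sum_mono)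
      with elim z(2)[OF w] show False by linarith
    qed
  qed
qed

text \<open>After the division every term except that of \<open>m\<close> carries a negative power
  of \<open>R\<close>.\<close>

lemma tendsto_lacunary_sum:
  fixes a :: "'b \<Rightarrow> 'a::real_normed_vector" and e :: "'b \<Rightarrow> nat"
  assumes "finite A" "m \<in> A" and e: "\<And>j. j \<in> A \<Longrightarrow> j \<noteq> m \<Longrightarrow> e j < e m"
  shows "((\<lambda>R::real. (\<Sum>j\<in>A. R ^ e j *\<^sub>R a j) /\<^sub>R R ^ e m) \<longlongrightarrow> a m) at_top"
proof -
  have quot: "((\<lambda>R::real. inverse (R ^ e m) * R ^ e j) \<longlongrightarrow> (if j = m then 1 else 0)) at_top"
    if "j \<in> A" for j
  proof (cases "j = m")
    case True
    have "\<forall>\<^sub>F R::real in at_top. inverse (R ^ e m) * R ^ e j = 1"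
      using eventually_gt_at_top[of 0] by eventually_elim (simp add: True)
    then show ?thesis by (simp add: True tendsto_eventually)
  next
    case False
    then have pos: "e m - e j > 0" using e[OF that] by simp
    have "((\<lambda>R::real. inverse (R ^ (e m - e j))) \<longlongrightarrow> 0) at_top"
      using filterlim_pow_at_top[OF pos filterlim_ident]
      by (rule tendsto_inverse_0_at_top)
    moreover have "\<forall>\<^sub>F R::real in at_top.
        inverse (R ^ (e m - e j)) = inverse (R ^ e m) * R ^ e j"
      using eventually_gt_at_top[of 0]
    proof eventually_elim
      case (elim R)
      have "R ^ e m = R ^ (e m - e j) * R ^ e j"
        using pos by (simp flip: power_add)
      with elim show ?case by (simp add: field_simps)
    qed
    ultimately show ?thesis using False by (simp add: tendsto_cong)
  qed
  have "((\<lambda>R::real. \<Sum>j\<in>A. (inverse (R ^ e m) * R ^ e j) *\<^sub>R a j) \<longlongrightarrow>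
      (\<Sum>j\<in>A. (if j = m then 1 else 0) *\<^sub>R a j)) at_top"
    by (intro tendsto_intros quot)
  also have "(\<Sum>j\<in>A. (if j = m then 1 else 0) *\<^sub>R a j) = (\<Sum>j\<in>A. if j = m then a j else 0)"
    by (rule sum.cong) auto
  also have "\<dots> = a m" using assms(1,2) by simp
  finally show ?thesis by (simp add: scaleR_sum_right)
qed

section \<open>Duality for linear independence and convex hulls\<close>

lemma lin_indep_family_orthogonal_imp_zero:
  fixes v :: "nat \<Rightarrow> real ^ 'd"
  assumes "lin_indep_family I v" "card I = CARD('d)" and w: "\<And>i. i \<in> I \<Longrightarrow> w \<bullet> v i = 0"
  shows "w = 0"
proof -
  have "independent (v ` I)" "card (v ` I) = CARD('d)"
    using assms(1,2) by (auto simp: lin_indep_family_def card_image)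
  then have "UNIV \<subseteq> span (v ` I)"
    by (intro card_ge_dim_independent) auto
  then have "w \<in> span (v ` I)" by blast
  then have "orthogonal w w"
    by (rule orthogonal_to_span) (use w in \<open>auto simp: orthogonal_def\<close>)
  then show ?thesis by (simp add: orthogonal_def)
qed

text \<open>A unit normal to a proper span would contradict the hypothesis on \<open>w\<close>, so
  the family spans. Spanning by \<open>d\<close> indices forces \<open>d\<close> distinct vectors,
  which yields both injectivity and independence.\<close>

lemma lin_indep_familyI_orthogonal:
  fixes v :: "nat \<Rightarrow> real ^ 'd"
  assumes "finite I" "card I = CARD('d)"
    and w: "\<And>w. norm w = 1 \<Longrightarrow> \<exists>i\<in>I. w \<bullet> v i \<noteq> 0"
  shows "lin_indep_family I v"
proof -
  have span: "span (v ` I) = UNIV"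
  proof (rule ccontr)
    assume "span (v ` I) \<noteq> UNIV"
    then obtain a where a: "a \<noteq> 0" "\<forall>x\<in>span (v ` I). a \<bullet> x = 0"
      using span_not_UNIV_orthogonal by blast
    from w[of "a /\<^sub>R norm a"] a(1) obtain i where "i \<in> I" "a \<bullet> v i \<noteq> 0" by auto
    with a(2) show False by (auto intro: span_base)
  qed
  have fin: "finite (v ` I)" using assms(1) by simp
  have "CARD('d) \<le> card (v ` I)"
    using dim_le_card[of UNIV "v ` I"] span fin by simp
  then have card: "card (v ` I) = card I"
    using card_image_le[OF assms(1), of v] assms(2) by linarith
  then have "inj_on v I" using assms(1) eq_card_imp_inj_on by blast
  moreover have "independent (v ` I)"
    using span fin card assms(2) by (intro card_le_dim_spanning[of _ UNIV]) auto
  ultimately show ?thesis by (simp add: lin_indep_family_def)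
qed

lemma ex_dominating_index:
  assumes "finite A" "A \<noteq> {}" "inj_on \<sigma> A"
  obtains m where "m \<in> A" "\<And>j. j \<in> A \<Longrightarrow> j \<noteq> m \<Longrightarrow> \<sigma> j < (\<sigma> m :: nat)"
proof -
  have "Max (\<sigma> ` A) \<in> \<sigma> ` A" using assms by simp
  then obtain m where m: "m \<in> A" "\<sigma> m = Max (\<sigma> ` A)" by auto
  have "\<sigma> j < \<sigma> m" if "j \<in> A" "j \<noteq> m" for j
  proof -
    have "\<sigma> j \<le> \<sigma> m" using that assms m(2) by simp
    moreover have "\<sigma> j \<noteq> \<sigma> m" using that m(1) assms(3) by (auto dest: inj_onD)
    ultimately show ?thesis by simp
  qed
  with m(1) show ?thesis by (rule that)
qed

lemma zero_notin_convex_hull_separation: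
  fixes S :: "'a::euclidean_space set"
  assumes "finite S" "0 \<notin> convex hull S"
  obtains w where "w \<noteq> 0" "\<And>x. x \<in> S \<Longrightarrow> w \<bullet> x > 0"
proof -
  have "closed (convex hull S)"
    using assms(1) by (simp add: finite_imp_compact_convex_hull compact_imp_closed)
  then obtain w b where "w \<noteq> 0" "0 < b" "\<forall>x\<in>convex hull S. w \<bullet> x > b"
    using separating_hyperplane_closed_0[OF convex_convex_hull _ assms(2)] by blast
  then show ?thesis using that[of w] hull_subset[of S convex] by fastforce
qed

lemma zero_notin_convex_hullI:
  fixes S :: "'a::real_inner set"
  assumes "\<And>x. x \<in> S \<Longrightarrow> w \<bullet> x > 0"
  shows "0 \<notin> convex hull S"
proof -
  have "convex hull S \<subseteq> {x. w \<bullet> x > 0}"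
    using assms by (intro hull_minimal convex_halfspace_gt) auto
  then show ?thesis by auto
qed

section \<open>The walk of one signed permutation\<close>

locale signed_lacunary =
  fixes u :: "nat \<Rightarrow> real ^ 'd" and n :: nat and \<sigma> :: "nat \<Rightarrow> nat" and \<epsilon> :: "nat \<Rightarrow> real"
  assumes glp: "general_linear_position n u"
    and perm: "\<sigma> permutes {1..n}"
    and signs: "\<And>i. i \<in> {1..n} \<Longrightarrow> \<epsilon> i \<noteq> 0"
begin

text \<open>These are the limit directions: a rescaled block sum whose largest value of
  \<open>\<sigma>\<close> is attained at \<open>i\<close> tends to \<open>a i\<close>.\<close>

definition a where "a i = \<epsilon> i *\<^sub>R u (\<sigma> i)"

definition walk where "walk R = partial_sum (signed_act (\<sigma>, \<epsilon>) (lacunary_config u R))"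

lemma walk_eq: "walk R k = (\<Sum>j = 1..k. R ^ (\<sigma> j - 1) *\<^sub>R a j)"
  by (simp add: walk_def partial_sum_def lacunary_config_def a_def mult.commute)

lemma inj_sigma: "inj_on \<sigma> A"
  using perm by (meson permutes_inj_on)

lemma sigma_bounds: "i \<in> {1..n} \<Longrightarrow> 1 \<le> \<sigma> i \<and> \<sigma> i \<le> n"
  using permutes_in_image[OF perm, of i] by simp

lemma tendsto_block:
  assumes A: "A \<subseteq> {1..n}" "m \<in> A" and m: "\<And>j. j \<in> A \<Longrightarrow> j \<noteq> m \<Longrightarrow> \<sigma> j < \<sigma> m"
  shows "((\<lambda>R. (\<Sum>j\<in>A. R ^ (\<sigma> j - 1) *\<^sub>R a j) /\<^sub>R R ^ (\<sigma> m - 1)) \<longlongrightarrow> a m) at_top"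
proof (rule tendsto_lacunary_sum)
  show "finite A" using A finite_subset by blast
  \<comment> \<open>Since \<open>\<sigma> j \<ge> 1\<close>, the truncated subtraction preserves
    strictness.\<close>
  show "\<sigma> j - 1 < \<sigma> m - 1" if "j \<in> A" "j \<noteq> m" for j
    using m[OF that] sigma_bounds[of j] that(1) A(1) by (auto intro!: diff_less_mono)
qed (rule A(2))

text \<open>The \<open>a j\<close> are nonzero multiples of \<open>d\<close> distinct vectors
  \<open>u i\<close>, which form a basis by general position.\<close>

lemma orthogonal_imp_zero:
  assumes "J \<subseteq> {1..n}" "card J = CARD('d)" "\<And>j. j \<in> J \<Longrightarrow> w \<bullet> a j = 0"
  shows "w = 0"
proof (rule lin_indep_family_orthogonal_imp_zero)
  have card: "card (\<sigma> ` J) = CARD('d)"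
    using assms(2) by (simp add: card_image inj_sigma)
  then show "card (\<sigma> ` J) = CARD('d)" .
  have "\<sigma> ` J \<subseteq> {1..n}"
    using permutes_image[OF perm] assms(1) by blast
  then show "lin_indep_family (\<sigma> ` J) u"
    using glp card by (auto simp: general_linear_position_def)
  show "w \<bullet> u i = 0" if "i \<in> \<sigma> ` J" for i
  proof -
    from that obtain j where j: "j \<in> J" "i = \<sigma> j" by blast
    then show ?thesis using assms(3)[OF j(1)] signs[of j] assms(1) by (auto simp: a_def)
  qed
qed

text \<open>Moving signs into the coefficients and reindexing by \<open>\<sigma>\<close> turns the
  relation into one among \<open>card J\<close> distinct vectors \<open>u i\<close>; general
  position forbids it for at most \<open>d\<close> of them.\<close>

lemma combination_zero_card:
  assumes J: "J \<subseteq> {1..n}" "J \<noteq> {}" and c: "\<And>j. j \<in> J \<Longrightarrow> c j \<noteq> 0"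
    and sum: "(\<Sum>j\<in>J. c j *\<^sub>R a j) = 0"
  shows "card J > CARD('d)"
proof (rule ccontr)
  assume "\<not> card J > CARD('d)"
  moreover have fin: "finite J" using J finite_subset by blast
  ultimately have "1 \<le> card (\<sigma> ` J)" "card (\<sigma> ` J) \<le> CARD('d)"
    using J(2) by (simp_all add: card_image inj_sigma Suc_le_eq card_gt_0_iff)
  moreover have "\<sigma> ` J \<subseteq> {1..n}"
    using permutes_image[OF perm] J(1) by blast
  ultimately have indep: "lin_indep_family (\<sigma> ` J) u"
    using glp by (auto simp: general_linear_position_def)
  let ?c = "\<lambda>i. c (inv \<sigma> i) * \<epsilon> (inv \<sigma> i)"
  have inv: "inv \<sigma> (\<sigma> j) = j" for j
    using perm by (simp add: permutes_inverses)
  have "(\<Sum>i\<in>\<sigma> ` J. ?c i *\<^sub>R u i) = (\<Sum>j\<in>J. c j *\<^sub>R a j)"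
    by (simp add: sum.reindex inj_sigma inv a_def)
  then have "(\<Sum>i\<in>\<sigma> ` J. ?c i *\<^sub>R u i) = 0" using sum by simp
  then have "\<forall>i\<in>\<sigma> ` J. ?c i = 0"
    by (rule lin_indep_family_iff[THEN iffD1, OF finite_imageI[OF fin] indep, THEN spec, THEN mp])
  then have "c j * \<epsilon> j = 0" if "j \<in> J" for j using that by (auto simp: inv)
  with J c signs show False by (metis all_not_in_conv mult_eq_0_iff subsetD)
qed

section \<open>Regularity\<close>

lemma eventually_lin_indep:
  assumes I: "I \<subseteq> {1..n}" "card I = CARD('d)"
  shows "\<forall>\<^sub>F R in at_top. lin_indep_family I (walk R)"
proof -
  have fin: "finite I" using I finite_subset by blast
  \<comment> \<open>The predecessor of \<open>i\<close> in \<open>I\<close>, or 0 for the least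
    element; as \<open>walk R 0 = 0\<close>, the first block then needs no separate
    treatment.\<close>
  define p where "p i = Max (insert 0 {i'\<in>I. i' < i})" for i
  have p_in: "p i \<in> insert 0 {i'\<in>I. i' < i}" for i
    unfolding p_def using fin by (intro Max_in) auto
  have p_ge: "i' \<le> p i" if "i' \<in> I" "i' < i" for i i'
    unfolding p_def using fin that by (intro Max_ge) auto
  have p_less: "p i < i" if "i \<in> I" for i
    using p_in[of i] that I(1) by auto
  define B where "B i = {p i<..i}" for i
  have B_sub: "B i \<subseteq> {1..n}" if "i \<in> I" for i
    using that I(1) by (auto simp: B_def)
  have "\<exists>m. m \<in> B i \<and> (\<forall>j\<in>B i. j \<noteq> m \<longrightarrow> \<sigma> j < \<sigma> m)" if "i \<in> I" for i
  proof -
    have "finite (B i)" "B i \<noteq> {}" using p_less[OF that] by (auto simp: B_def)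
    then show ?thesis by (rule ex_dominating_index[OF _ _ inj_sigma]) blast
  qed
  then obtain m where m: "\<And>i. i \<in> I \<Longrightarrow> m i \<in> B i"
      "\<And>i j. i \<in> I \<Longrightarrow> j \<in> B i \<Longrightarrow> j \<noteq> m i \<Longrightarrow> \<sigma> j < \<sigma> (m i)"
    by metis
  \<comment> \<open>The blocks are disjoint: for \<open>i < j\<close> in \<open>I\<close>,
    \<open>m i \<le> i \<le> p j < m j\<close>.\<close>
  have "inj_on m I"
  proof (rule linorder_inj_onI')
    fix i j assume "i \<in> I" "j \<in> I" "i < j"
    then show "m i \<noteq> m j"
      using m(1)[of i] m(1)[of j] p_ge[of i j] by (auto simp: B_def)
  qed
  then have m_image: "m ` I \<subseteq> {1..n}" "card (m ` I) = CARD('d)"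
    using m(1) B_sub I(2) by (auto simp: card_image)
  define V where "V i R = (\<Sum>j\<in>B i. R ^ (\<sigma> j - 1) *\<^sub>R a j) /\<^sub>R R ^ (\<sigma> (m i) - 1)" for i R
  have "\<forall>\<^sub>F R in at_top. \<forall>w. norm w = 1 \<longrightarrow> (\<exists>i\<in>I. w \<bullet> V i R \<notin> {0})"
  proof (rule eventually_no_unit_vector_inner_in[OF fin])
    show "(V i \<longlongrightarrow> a (m i)) at_top" if "i \<in> I" for i
      unfolding V_def using tendsto_block[OF B_sub m(1) m(2)] that by blast
    show "\<exists>i\<in>I. w \<bullet> a (m i) \<notin> {0}" if "norm w = 1" for w
      using orthogonal_imp_zero[OF m_image, of w] that by force
  qed auto
  then show ?thesis
  proof eventually_elim
    case (elim R)
    show ?case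
    proof (rule lin_indep_familyI_orthogonal[OF fin I(2)], rule ccontr)
      fix w :: "real ^ 'd"
      assume w: "norm w = 1" and "\<not> (\<exists>i\<in>I. w \<bullet> walk R i \<noteq> 0)"
      then have orth: "w \<bullet> walk R i = 0" if "i \<in> insert 0 I" for i
        using that by (auto simp: walk_eq)
      \<comment> \<open>The block sum is the difference of the walk at \<open>i\<close> and at
        \<open>p i\<close>, both orthogonal to \<open>w\<close>; rescaling keeps
        orthogonality.\<close>
      have "w \<bullet> V i R = 0" if "i \<in> I" for i
      proof -
        have "{1..i} = {1..p i} \<union> B i" "{1..p i} \<inter> B i = {}"
          using p_less[OF that] by (auto simp: B_def)
        then have "walk R i = walk R (p i) + (\<Sum>j\<in>B i. R ^ (\<sigma> j - 1) *\<^sub>R a j)"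
          unfolding walk_eq by (simp add: sum.union_disjoint B_def)
        moreover have "w \<bullet> walk R i = 0" "w \<bullet> walk R (p i) = 0"
          using orth p_in[of i] that by auto
        ultimately have "w \<bullet> (\<Sum>j\<in>B i. R ^ (\<sigma> j - 1) *\<^sub>R a j) = 0"
          by (simp add: inner_add_right)
        then show ?thesis by (simp add: V_def)
      qed
      with elim w show False by blast
    qed
  qed
qed

section \<open>Zero in the limiting hull and in the hull of the walk\<close>

text \<open>This places 0 in the interior of the limiting hull. If all inner products with
  \<open>w\<close> were nonnegative, every vector with positive weight in a convex combination equal
  to 0 would be orthogonal to \<open>w\<close>. By \<open>combination_zero_card\<close> there are
  more than \<open>d\<close> of them, and any \<open>d\<close> already force
  \<open>w = 0\<close>.\<close>

lemma no_unit_vector_inner_nonneg: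
  assumes zero: "0 \<in> convex hull (a ` S)" and S: "S \<subseteq> {1..n}" and w: "norm w = 1"
  shows "\<exists>r\<in>S. w \<bullet> a r \<notin> {0..}"
proof (rule ccontr)
  assume "\<not> ?thesis"
  then have nonneg: "w \<bullet> a r \<ge> 0" if "r \<in> S" for r using that by auto
  have fin: "finite (a ` S)" using S finite_subset by blast
  from zero obtain c where c: "\<And>x. x \<in> a ` S \<Longrightarrow> 0 \<le> c x" "sum c (a ` S) = 1"
      "(\<Sum>x\<in>a ` S. c x *\<^sub>R x) = 0"
    unfolding convex_hull_finite[OF fin] by auto
  have c_inner: "c x * (w \<bullet> x) = 0" if "x \<in> a ` S" for x
  proof -
    have "(\<Sum>x\<in>a ` S. c x * (w \<bullet> x)) = w \<bullet> (\<Sum>x\<in>a ` S. c x *\<^sub>R x)"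
      by (simp add: inner_sum_right)
    also have "\<dots> = 0" by (simp add: c(3))
    finally show ?thesis
      using sum_nonneg_eq_0_iff[OF fin, of "\<lambda>x. c x * (w \<bullet> x)"] c(1) nonneg that by fastforce
  qed
  \<comment> \<open>The weights belong to vectors, while general position speaks of indices; hence
    one index is chosen for each vector of the support.\<close>
  have "{x \<in> a ` S. c x \<noteq> 0} \<subseteq> a ` S" by blast
  then obtain J where J: "J \<subseteq> S" "inj_on a J" "{x \<in> a ` S. c x \<noteq> 0} = a ` J"
    unfolding subset_image_inj by blast
  have J_sub: "J \<subseteq> {1..n}" using J(1) S by blast
  have cJ: "c (a j) \<noteq> 0" if "j \<in> J" for j using J(3) that by blast
  have "J \<noteq> {}"
  proof
    assume "J = {}"
    then have "\<forall>x\<in>a ` S. c x = 0" using J(3) by blast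
    with c(2) show False by simp
  qed
  moreover have "(\<Sum>j\<in>J. c (a j) *\<^sub>R a j) = 0"
  proof -
    have "(\<Sum>j\<in>J. c (a j) *\<^sub>R a j) = (\<Sum>x\<in>a ` J. c x *\<^sub>R x)"
      by (simp add: sum.reindex J(2))
    also have "\<dots> = (\<Sum>x\<in>a ` S. c x *\<^sub>R x)"
      unfolding J(3)[symmetric] using fin by (intro sum.mono_neutral_left) auto
    finally show ?thesis using c(3) by simp
  qed
  ultimately have "card J > CARD('d)"
    using combination_zero_card[OF J_sub, of "\<lambda>j. c (a j)"] cJ by blast
  then obtain J' where J': "J' \<subseteq> J" "card J' = CARD('d)"
    using obtain_subset_with_card_n[of "CARD('d)" J] by auto
  have "w = 0"
  proof (rule orthogonal_imp_zero[OF _ J'(2)])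
    show "J' \<subseteq> {1..n}" using J'(1) J_sub by blast
    show "w \<bullet> a j = 0" if "j \<in> J'" for j
      using c_inner[of "a j"] cJ[of j] that J'(1) J(1) by auto
  qed
  with w show False by simp
qed

text \<open>The partial sums at the records alone suffice: once rescaled they tend to the
  \<open>a r\<close>, so eventually no \<open>w\<close> can separate them from 0.\<close>

lemma eventually_zero_in_walk_hull:
  assumes "0 \<in> convex hull (a ` records n \<sigma>)"
  shows "\<forall>\<^sub>F R in at_top. 0 \<in> convex hull (walk R ` {1..n})"
proof -
  have rec: "records n \<sigma> \<subseteq> {1..n}" by (auto simp: records_def)
  have "\<forall>\<^sub>F R in at_top. \<forall>w. norm w = 1 \<longrightarrow>
      (\<exists>r\<in>records n \<sigma>. w \<bullet> (walk R r /\<^sub>R R ^ (\<sigma> r - 1)) \<notin> {0..})"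
  proof (rule eventually_no_unit_vector_inner_in)
    show "finite (records n \<sigma>)" using rec finite_subset by blast
    \<comment> \<open>At a record \<open>r\<close> the dominating index of \<open>{1..r}\<close> is
      \<open>r\<close> itself.\<close>
    show "((\<lambda>R. walk R r /\<^sub>R R ^ (\<sigma> r - 1)) \<longlongrightarrow> a r) at_top" if "r \<in> records n \<sigma>" for r
      unfolding walk_eq using that by (intro tendsto_block) (auto simp: records_def)
  qed (use no_unit_vector_inner_nonneg[OF assms rec] in auto)
  then show ?thesis using eventually_gt_at_top[of 0]
  proof eventually_elim
    case (elim R)
    show ?case
    proof (rule ccontr)
      assume "0 \<notin> convex hull (walk R ` {1..n})"
      then obtain w where w: "w \<noteq> 0" "\<And>x. x \<in> walk R ` {1..n} \<Longrightarrow> w \<bullet> x > 0"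
        by (rule zero_notin_convex_hull_separation[rotated]) auto
      \<comment> \<open>The separating vector is normalised, and positivity is weakened to
        membership in the closed set \<open>{0..}\<close>.\<close>
      have "(w /\<^sub>R norm w) \<bullet> (walk R r /\<^sub>R R ^ (\<sigma> r - 1)) \<ge> 0" if "r \<in> records n \<sigma>" for r
        using w(2)[of "walk R r"] rec that elim(2) by auto
      moreover have "norm (w /\<^sub>R norm w) = 1" using w(1) by simp
      ultimately show False using elim(1) by (metis atLeast_iff)
    qed
  qed
qed

text \<open>A \<open>w\<close> that is positive on the record directions is eventually positive on
  every partial sum, since each of these is dominated by a record.\<close>

lemma eventually_zero_notin_walk_hull:
  assumes "0 \<notin> convex hull (a ` records n \<sigma>)"
  shows "\<forall>\<^sub>F R in at_top. 0 \<notin> convex hull (walk R ` {1..n})"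
proof -
  have "finite (a ` records n \<sigma>)" by (simp add: records_def)
  then obtain w where "\<And>x. x \<in> a ` records n \<sigma> \<Longrightarrow> w \<bullet> x > 0"
    using zero_notin_convex_hull_separation[OF _ assms] by metis
  then have w: "w \<bullet> a r > 0" if "r \<in> records n \<sigma>" for r using that by blast
  have "\<forall>\<^sub>F R in at_top. w \<bullet> walk R k > 0" if k: "k \<in> {1..n}" for k
  proof -
    obtain r where r: "r \<in> {1..k}" "\<And>j. j \<in> {1..k} \<Longrightarrow> j \<noteq> r \<Longrightarrow> \<sigma> j < \<sigma> r"
      by (rule ex_dominating_index[OF _ _ inj_sigma, where A = "{1..k}"]) (use k in auto)
    \<comment> \<open>The maximiser of \<open>\<sigma>\<close> on \<open>{1..k}\<close> is the last
      record up to \<open>k\<close>.\<close>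
    have "r \<in> records n \<sigma>" using r k by (auto simp: records_def)
    have "((\<lambda>R. walk R k /\<^sub>R R ^ (\<sigma> r - 1)) \<longlongrightarrow> a r) at_top"
      unfolding walk_eq using r k by (intro tendsto_block) auto
    then have "((\<lambda>R. w \<bullet> (walk R k /\<^sub>R R ^ (\<sigma> r - 1))) \<longlongrightarrow> w \<bullet> a r) at_top"
      by (intro tendsto_intros)
    then have "\<forall>\<^sub>F R in at_top. w \<bullet> (walk R k /\<^sub>R R ^ (\<sigma> r - 1)) > 0"
      using w[OF \<open>r \<in> records n \<sigma>\<close>] by (rule order_tendstoD)
    then show ?thesis using eventually_gt_at_top[of 0]
      by eventually_elim (simp add: zero_less_mult_iff)
  qed
  then have "\<forall>\<^sub>F R in at_top. \<forall>k\<in>{1..n}. w \<bullet> walk R k > 0"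
    by (intro eventually_ball_finite) auto
  then show ?thesis
    by eventually_elim (rule zero_notin_convex_hullI[of _ w], auto)
qed

lemma eventually_regular_and_hull_iff:
  "\<forall>\<^sub>F R in at_top.
    (\<forall>I \<subseteq> {1..n}. card I = CARD('d) \<longrightarrow> lin_indep_family I (walk R)) \<and>
    (0 \<in> convex hull (walk R ` {1..n}) \<longleftrightarrow> 0 \<in> convex hull (a ` records n \<sigma>))"
proof (intro eventually_conj)
  have "\<forall>\<^sub>F R in at_top. \<forall>I\<in>{I. I \<subseteq> {1..n} \<and> card I = CARD('d)}. lin_indep_family I (walk R)"
    using eventually_lin_indep by (intro eventually_ball_finite) simp_all
  then show "\<forall>\<^sub>F R in at_top. \<forall>I \<subseteq> {1..n}. card I = CARD('d) \<longrightarrow> lin_indep_family I (walk R)"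
    by eventually_elim blast
  show "\<forall>\<^sub>F R in at_top.
      0 \<in> convex hull (walk R ` {1..n}) \<longleftrightarrow> 0 \<in> convex hull (a ` records n \<sigma>)"
    using eventually_zero_in_walk_hull eventually_zero_notin_walk_hull
    by (cases "0 \<in> convex hull (a ` records n \<sigma>)") simp_all
qed

end

section \<open>Uniformity over the signed permutations\<close>

lemma finite_signed_perms: "finite (signed_perms n)"
  by (simp add: signed_perms_def finite_permutations finite_PiE)

theorem proposition11:
  fixes u :: "nat \<Rightarrow> real ^ 'd" and n :: nat
  assumes "n \<ge> CARD('d) + 1"
    and "\<And>i. i \<in> {1..n} \<Longrightarrow> norm (u i) = 1"
    and "general_linear_position n u"
  shows "\<exists>R0 > 1. \<forall>R \<ge> R0.
    regular_config n (lacunary_config u R) \<and>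
    (\<forall>(\<sigma>, \<epsilon>) \<in> signed_perms n.
       0 \<in> walk_hull n (signed_act (\<sigma>, \<epsilon>) (lacunary_config u R)) \<longleftrightarrow>
       0 \<in> convex hull ((\<lambda>i. \<epsilon> i *\<^sub>R u (\<sigma> i)) ` records n \<sigma>))"
proof -
  let ?P = "\<lambda>R g. (\<forall>I \<subseteq> {1..n}. card I = CARD('d) \<longrightarrow>
      lin_indep_family I (partial_sum (signed_act g (lacunary_config u R)))) \<and>
    (0 \<in> walk_hull n (signed_act g (lacunary_config u R)) \<longleftrightarrow>
     0 \<in> convex hull ((\<lambda>i. snd g i *\<^sub>R u (fst g i)) ` records n (fst g)))"
  have "\<forall>\<^sub>F R in at_top. ?P R g" if g: "g \<in> signed_perms n" for g
  proof -
    obtain \<sigma> \<epsilon> where g_eq: "g = (\<sigma>, \<epsilon>)" by (cases g)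
    have \<sigma>: "\<sigma> permutes {1..n}" and \<epsilon>: "\<epsilon> \<in> {1..n} \<rightarrow>\<^sub>E {-1, 1}"
      using g by (auto simp: g_eq signed_perms_def)
    interpret signed_lacunary u n \<sigma> \<epsilon>
      using assms(3) \<sigma> PiE_mem[OF \<epsilon>] by unfold_locales force+
    show ?thesis
      using eventually_regular_and_hull_iff
      by (simp add: g_eq walk_hull_def walk_def a_def[abs_def])
  qed
  \<comment> \<open>The group is finite, so the thresholds of the individual \<open>g\<close> merge
    into one.\<close>
  then have "\<forall>\<^sub>F R in at_top. \<forall>g\<in>signed_perms n. ?P R g"
    using finite_signed_perms by (intro eventually_ball_finite) auto
  then obtain N where N: "\<And>R g. R \<ge> N \<Longrightarrow> g \<in> signed_perms n \<Longrightarrow> ?P R g"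
    unfolding eventually_at_top_linorder by blast
  show ?thesis
  \<comment> \<open>The maximum with 2 secures \<open>R0 > 1\<close>, as \<open>N\<close> may be any
    real number.\<close>
  proof (intro exI[of _ "max N 2"] conjI allI impI)
    fix R assume "R \<ge> max N 2"
    then have "R \<ge> N" by simp
    note P = N[OF this]
    show "regular_config n (lacunary_config u R)"
      unfolding regular_config_def using P by blast
    show "\<forall>(\<sigma>, \<epsilon>) \<in> signed_perms n.
       0 \<in> walk_hull n (signed_act (\<sigma>, \<epsilon>) (lacunary_config u R)) \<longleftrightarrow>
       0 \<in> convex hull ((\<lambda>i. \<epsilon> i *\<^sub>R u (\<sigma> i)) ` records n \<sigma>)"
      using P by fastforce
  qed simp
qed

end
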